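(* The invertible enhancement operator $$\mu=\begin{pmatrix}1&0\\0&-1\end{pmatrix}$$ cannot be obtained from cup and cap matrices: there is no invertible complex $2\times2$ matrix $M$ such that $M\,N^{\top}=\mu$, where $N=M^{-1}$.
   Context: In a quantum link state sum, a minimum (cup) is assigned a matrix $M=(M^{ab})$ and a maximum (cap) a matrix $N=(M_{ab})$, which must be inverse to each other. When a strand of a braid is closed up by a cup and a cap, with $b$ the endpoint at the top of the braid, $a$ the endpoint at the bottom, and $i$ the point where cup and cap are joined, the resulting operator is $\mu=M N^{\top}$ (a product of the cup and cap matrices contracted over $i$); this is the state sum counterpart of the enhancement operator $\mu$ of an enhanced Yang-Baxter operator. *)

theory Defs
  imports "HOL-Analysis.Analysis"
begin

(* Entry (b, a) of the result is the sum over i of cup $ b $ i * cap $ a $ i: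
   b is the endpoint at the top of the braid, a the endpoint at the bottom,
   and i the point where cup and cap are joined. *)
definition cup_cap_operator :: "complex^'n^'n \<Rightarrow> complex^'n^'n \<Rightarrow> complex^'n^'n" where
  "cup_cap_operator cup cap = cup ** transpose cap"

definition signed_mu :: "complex^2^2" where
  "signed_mu = vector [vector [1, 0], vector [0, -1]]"

end

theory Submission
  imports Defs
begin

text \<open>
  The obstruction is the determinant. Transposition preserves determinants, so for mutually inverse
  cup and cap matrices the operator always has determinant \<open>det M * det (M\<inverse>) = 1\<close>, whereas the
  diagonal matrix with entries 1 and -1 has determinant -1. The same value -1, being nonzero,
  gives its invertibility.
\<close>

lemma matrix_mul_matrix_inv:
  fixes A :: "'a::semiring_1^'n^'m"
  assumes "invertible A"
  shows "A ** matrix_inv A = mat 1"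
  using someI_ex[OF assms[unfolded invertible_def]] unfolding matrix_inv_def by blast

lemma det_cup_cap_operator_matrix_inv:
  fixes M :: "complex^'n^'n"
  assumes "invertible M"
  shows "det (cup_cap_operator M (matrix_inv M)) = 1"
proof -
  have "det (cup_cap_operator M (matrix_inv M)) = det (M ** matrix_inv M)"
    by (simp add: cup_cap_operator_def det_mul)
  also have "\<dots> = 1"
    using matrix_mul_matrix_inv[OF assms] by simp
  finally show ?thesis .
qed

lemma det_signed_mu: "det signed_mu = -1"
  by (simp add: signed_mu_def det_2)

theorem mainTheorem8:
  shows "invertible signed_mu \<and>
    \<not> (\<exists>M :: complex^2^2. invertible M \<and> cup_cap_operator M (matrix_inv M) = signed_mu)"
proof
  show "invertible signed_mu"
    by (simp add: invertible_det_nz det_signed_mu)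
  show "\<not> (\<exists>M :: complex^2^2. invertible M \<and> cup_cap_operator M (matrix_inv M) = signed_mu)"
  proof
    assume "\<exists>M :: complex^2^2. invertible M \<and> cup_cap_operator M (matrix_inv M) = signed_mu"
    then have "det signed_mu = 1"
      using det_cup_cap_operator_matrix_inv by metis
    then show False
      by (simp add: det_signed_mu)
  qed
qed

end
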